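(* Let $\mathbb{B}$ be a set, let $p\geq 1$ be an integer, let $\theta=(\theta_1,\dots,\theta_p)\in\mathbb{R}^p$, and let $f_1,\dots,f_p:\mathbb{B}\times\mathbb{B}\to\mathbb{R}$ be features. Let $\rho:\mathbb{B}\times\mathbb{B}\to(0,1)$ be the logistic connectivity kernel given by $$\operatorname{logit}\rho(x,y)=\sum_{l=1}^p\theta_l f_l(x,y).$$ Suppose that (i) the kernel is homophilous, meaning that $\theta_l<0$ for every $l$ and that $\rho(x,y)<\rho(y,y)$ for all $x,y\in\mathbb{B}$ with $x\neq y$; and (ii) for each $l$, either $f_l$ is a constant function, or $f_l$ is a positive affine transform of a metric, i.e. there are a metric $d_l$ on $\mathbb{B}$ and real numbers $a_l>0$ and $b_l$ such that $f_l(x,y)=a_l d_l(x,y)+b_l$ for all $x,y\in\mathbb{B}$. Then the social separation $$\varphi(x,y)=\operatorname{logit}\rho(y,y)-\operatorname{logit}\rho(x,y)$$ is a metric on $\mathbb{B}$.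
   Context: $\mathbb{B}$ (the Blau space) is the set of possible attribute vectors of individuals; no further structure on it is needed. The connectivity kernel $\rho(x,y)$ is the probability that individuals with attributes $x$ and $y$ are connected. For $q\in(0,1)$, $\operatorname{logit}q=\log\left(\frac{q}{1-q}\right)$. *)

theory Defs
  imports "HOL-Analysis.Analysis"
begin

text \<open>
  The locale \<^locale>\<open>Metric_space\<close> asks for nonnegativity and symmetry on the whole type, not
  only on the carrier. A function that is meaningful only on \<open>B\<close> is therefore extended by
  zero; \<open>metric_on_iff\<close> shows that this amounts to the metric axioms on \<open>B\<close>.
\<close>

definition metric_on :: "'a set \<Rightarrow> ('a \<Rightarrow> 'a \<Rightarrow> real) \<Rightarrow> bool" where
  "metric_on B d \<longleftrightarrow> Metric_space B (\<lambda>x y. if x \<in> B \<and> y \<in> B then d x y else 0)"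

lemma metric_on_iff:
  "metric_on B d \<longleftrightarrow>
     (\<forall>x\<in>B. \<forall>y\<in>B. 0 \<le> d x y) \<and>
     (\<forall>x\<in>B. \<forall>y\<in>B. d x y = d y x) \<and>
     (\<forall>x\<in>B. \<forall>y\<in>B. d x y = 0 \<longleftrightarrow> x = y) \<and>
     (\<forall>x\<in>B. \<forall>y\<in>B. \<forall>z\<in>B. d x z \<le> d x y + d y z)"
  unfolding metric_on_def Metric_space_def by (auto; metis)

definition logit :: "real \<Rightarrow> real" where
  "logit q = ln (q / (1 - q))"

definition logistic_kernel ::
  "'a set \<Rightarrow> nat \<Rightarrow> (nat \<Rightarrow> real) \<Rightarrow> (nat \<Rightarrow> 'a \<Rightarrow> 'a \<Rightarrow> real) \<Rightarrow> ('a \<Rightarrow> 'a \<Rightarrow> real) \<Rightarrow> bool" where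
  "logistic_kernel B p \<theta> f \<rho> \<longleftrightarrow>
     (\<forall>x\<in>B. \<forall>y\<in>B. \<rho> x y \<in> {0<..<1} \<and> logit (\<rho> x y) = (\<Sum>l=1..p. \<theta> l * f l x y))"

definition homophilous ::
  "'a set \<Rightarrow> nat \<Rightarrow> (nat \<Rightarrow> real) \<Rightarrow> ('a \<Rightarrow> 'a \<Rightarrow> real) \<Rightarrow> bool" where
  "homophilous B p \<theta> \<rho> \<longleftrightarrow>
     (\<forall>l\<in>{1..p}. \<theta> l < 0) \<and> (\<forall>x\<in>B. \<forall>y\<in>B. x \<noteq> y \<longrightarrow> \<rho> x y < \<rho> y y)"

definition positive_affine_metric :: "'a set \<Rightarrow> ('a \<Rightarrow> 'a \<Rightarrow> real) \<Rightarrow> bool" where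
  "positive_affine_metric B g \<longleftrightarrow>
     (\<exists>d a b. metric_on B d \<and> a > 0 \<and> (\<forall>x\<in>B. \<forall>y\<in>B. g x y = a * d x y + b))"

definition social_separation :: "('a \<Rightarrow> 'a \<Rightarrow> real) \<Rightarrow> 'a \<Rightarrow> 'a \<Rightarrow> real" where
  "social_separation \<rho> x y = logit (\<rho> y y) - logit (\<rho> x y)"

end

theory Submission
  imports Defs
begin

text \<open>
  Subtracting its diagonal value turns every admissible feature into a pseudometric (zero, or
  \<open>a * d\<close>), so the social separation is a combination of pseudometrics with the nonnegative
  weights \<open>- \<theta> l\<close>. Since \<open>logit\<close> is strictly increasing, homophily separates points.
\<close>

text \<open>The odds \<open>q / (1 - q)\<close> increase because the numerator grows while the
  positive denominator shrinks; \<open>ln\<close> keeps the order strict.\<close>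

lemma logit_strict_mono:
  assumes "0 < q" "q < r" "r < 1"
  shows "logit q < logit r"
proof -
  have "q / (1 - q) < r / (1 - r)"
    using assms by (intro frac_less) auto
  with assms show ?thesis
    unfolding logit_def by (intro ln_strict_mono) auto
qed

lemma feature_increment:
  assumes "(\<lambda>(x, y). g x y) constant_on (B \<times> B) \<or> positive_affine_metric B g"
    and "x \<in> B" "y \<in> B" "z \<in> B"
  shows feature_increment_commute: "g x y - g y y = g y x - g x x"
    and feature_increment_triangle: "g x z - g z z \<le> (g x y - g y y) + (g y z - g z z)"
proof -
  have "g x y - g y y = g y x - g x x \<and> g x z - g z z \<le> (g x y - g y y) + (g y z - g z z)"
    using assms(1)
  proof
    assume "(\<lambda>(x, y). g x y) constant_on (B \<times> B)"
    then obtain c where "\<And>u v. u \<in> B \<Longrightarrow> v \<in> B \<Longrightarrow> g u v = c"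
      unfolding constant_on_def by auto
    with assms(2-) show ?thesis by simp
  next
    assume "positive_affine_metric B g"
    then obtain d a b where d: "metric_on B d" and "a > 0"
      and g: "\<And>u v. u \<in> B \<Longrightarrow> v \<in> B \<Longrightarrow> g u v = a * d u v + b"
      unfolding positive_affine_metric_def by blast
    \<comment> \<open>\<open>d v v = 0\<close> gives \<open>g v v = b\<close>, so the offset cancels
      and only the scaled metric remains.\<close>
    have incr: "g u v - g v v = a * d u v" if "u \<in> B" "v \<in> B" for u v
      using that d g by (simp add: metric_on_iff)
    have "d x y = d y x" "d x z \<le> d x y + d y z"
      using d assms(2-) unfolding metric_on_iff by blast+
    with \<open>a > 0\<close> assms(2-) show ?thesis
      by (simp add: incr flip: distrib_left)
  qed
  then show "g x y - g y y = g y x - g x x"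
    and "g x z - g z z \<le> (g x y - g y y) + (g y z - g z z)" by auto
qed

text \<open>Both logits are linear in the features with the same coefficients, so they subtract term
  by term. The minus sign goes to \<open>\<theta> l\<close>, which makes the weights positive under
  homophily.\<close>

lemma social_separation_eq_sum:
  assumes "logistic_kernel B p \<theta> f \<rho>" "x \<in> B" "y \<in> B"
  shows "social_separation \<rho> x y = (\<Sum>l=1..p. - \<theta> l * (f l x y - f l y y))"
  using assms unfolding social_separation_def logistic_kernel_def
  by (simp add: algebra_simps sum_subtractf)

theorem proposition2:
  fixes B :: "'a set" and p :: nat and \<theta> :: "nat \<Rightarrow> real"
    and f :: "nat \<Rightarrow> 'a \<Rightarrow> 'a \<Rightarrow> real" and \<rho> :: "'a \<Rightarrow> 'a \<Rightarrow> real"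
  assumes "p \<ge> 1"
    and "logistic_kernel B p \<theta> f \<rho>"
    and "homophilous B p \<theta> \<rho>"
    and "\<And>l. l \<in> {1..p} \<Longrightarrow>
           (\<lambda>(x, y). f l x y) constant_on (B \<times> B) \<or> positive_affine_metric B (f l)"
  shows "metric_on B (social_separation \<rho>)"
proof -
  \<comment> \<open>Homophily compares exactly the two kernel values whose logits are
    subtracted.\<close>
  have pos: "0 < social_separation \<rho> x y" if "x \<in> B" "y \<in> B" "x \<noteq> y" for x y
    using logit_strict_mono[of "\<rho> x y" "\<rho> y y"] that assms(2,3)
    by (simp add: social_separation_def logistic_kernel_def homophilous_def)
  have diag: "social_separation \<rho> x x = 0" for x
    by (simp add: social_separation_def)
  have commute: "social_separation \<rho> x y = social_separation \<rho> y x" if "x \<in> B" "y \<in> B" for x y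
    unfolding social_separation_eq_sum[OF assms(2) that]
      social_separation_eq_sum[OF assms(2) that(2,1)]
    \<comment> \<open>The two sides subtract different diagonal values, but the sums agree termwise.
      The third point \<open>z\<close> demanded by \<open>feature_increment_commute\<close> can be
      any point of \<open>B\<close>, such as \<open>x\<close> or \<open>y\<close>.\<close>
    using that by (intro sum.cong refl arg_cong2[where f = "(*)"]
        feature_increment_commute[OF assms(4)]) auto
  have triangle: "social_separation \<rho> x z \<le> social_separation \<rho> x y + social_separation \<rho> y z"
    if "x \<in> B" "y \<in> B" "z \<in> B" for x y z
  proof -
    \<comment> \<open>Each summand obeys its own triangle inequality, as a nonnegative weight
      preserves that of the increment.\<close>
    have "- \<theta> l * (f l x z - f l z z)
        \<le> - \<theta> l * (f l x y - f l y y) + - \<theta> l * (f l y z - f l z z)" if l: "l \<in> {1..p}" for l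
    proof -
      have "- \<theta> l \<ge> 0"
        using assms(3) l by (simp add: homophilous_def less_imp_le)
      from mult_left_mono[OF feature_increment_triangle[OF assms(4)[OF l]
          \<open>x \<in> B\<close> \<open>y \<in> B\<close> \<open>z \<in> B\<close>] this]
      show ?thesis by (simp only: distrib_left)
    qed
    then show ?thesis
      using that by (simp only: social_separation_eq_sum[OF assms(2)] flip: sum.distrib)
        (rule sum_mono)
  qed
  show ?thesis
    unfolding metric_on_iff
  proof (intro conjI ballI)
    fix x y assume "x \<in> B" "y \<in> B"
    then show "0 \<le> social_separation \<rho> x y" "social_separation \<rho> x y = 0 \<longleftrightarrow> x = y"
      \<comment> \<open>Split on \<open>x = y\<close>: \<open>diag\<close> covers equality, and
        \<open>pos\<close> gives a nonzero value otherwise.\<close>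
      using pos[of x y] diag[of x] by force+
  qed (fact commute triangle)+
qed

end
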